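(* Let $k,n,m\geq 2$ be integers with $n,m$ coprime (not necessarily $n<m$), and let $H=J\begin{pmatrix} k & n & m\\ 1 & n & m\end{pmatrix}\trianglelefteq J\begin{pmatrix} k & n & m\\ & & \end{pmatrix}=G$. Then $H$ has a presentation with generators $x_1,x_2,\dots,x_n$ and relations (indices taken modulo $n$) $$x_i^k=1\ \ \forall i=1,\dots,n,\qquad x_1x_2\cdots x_m=x_ix_{i+1}\cdots x_{i+m-1}\ \ \forall i=2,\dots,n.$$ If $n<m$ we therefore have $W(k,n,m)\cong H$. In terms of the generators $s,t,u$ of $G$ we have $x_i=t^{i-1}st^{-i+1}$ for all $i=1,\dots,n$.
   Context: $J$-groups: for integers $a,b,c\ge 2$, let $J\begin{pmatrix} a & b & c\\ & & \end{pmatrix}:=\langle s,t,u \mid s^a=t^b=u^c=1,\ stu=tus=ust\rangle$. If $a',b',c'$ are pairwise coprime positive integers with $a'\mid a$, $b'\mid b$, $c'\mid c$, then $J\begin{pmatrix} a & b & c\\ a' & b' & c'\end{pmatrix}$ is the normal closure of $\{s^{a'},t^{b'},u^{c'}\}$ in $J\begin{pmatrix} a & b & c\\ & & \end{pmatrix}$. Toric reflection group: for $k,n,m\ge2$ with $n<m$ coprime, $W(k,n,m)$ is the group with generators $x_1,\dots,x_n$ and relations $x_i^k=1$ for all $i$ together with the equality of the $n$ words $x_ix_{i+1}\cdots x_{i+m-1}$ ($m$ factors, $i=1,\dots,n$), indices modulo $n$. *)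

theory Defs
  imports "HOL-Algebra.Generated_Groups"
begin

section \<open>Group presentations\<close>

text \<open>A word over \<open>X\<close> is a list of signed letters; \<open>(x, True)\<close> stands for \<open>x\<close> and
  \<open>(x, False)\<close> for its inverse. A relation is a pair \<open>(l, r)\<close> of words, read as \<open>l = r\<close>.\<close>

type_synonym 'a word = "('a \<times> bool) list"

definition words :: "'a set \<Rightarrow> 'a word set" where
  "words X = lists (X \<times> UNIV)"

definition pos :: "'a list \<Rightarrow> 'a word" where
  "pos xs = map (\<lambda>x. (x, True)) xs"

text \<open>The least congruence on words over \<open>X\<close> containing free cancellation and \<open>R\<close>.
  Relations of \<open>R\<close> that are not between words over \<open>X\<close> are ignored.\<close>

inductive pres_eq :: "'a set \<Rightarrow> ('a word \<times> 'a word) set \<Rightarrow> 'a word \<Rightarrow> 'a word \<Rightarrow> bool"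
  for X R where
  refl: "w \<in> words X \<Longrightarrow> pres_eq X R w w"
| sym: "pres_eq X R v w \<Longrightarrow> pres_eq X R w v"
| trans: "pres_eq X R u v \<Longrightarrow> pres_eq X R v w \<Longrightarrow> pres_eq X R u w"
| cancel: "u \<in> words X \<Longrightarrow> v \<in> words X \<Longrightarrow> x \<in> X \<Longrightarrow>
    pres_eq X R (u @ [(x, b), (x, \<not> b)] @ v) (u @ v)"
| rel: "u \<in> words X \<Longrightarrow> v \<in> words X \<Longrightarrow> (l, r) \<in> R \<Longrightarrow> l \<in> words X \<Longrightarrow> r \<in> words X \<Longrightarrow>
    pres_eq X R (u @ l @ v) (u @ r @ v)"

definition pres_rel :: "'a set \<Rightarrow> ('a word \<times> 'a word) set \<Rightarrow> ('a word \<times> 'a word) set" where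
  "pres_rel X R = {(v, w). pres_eq X R v w}"

definition pres_group :: "'a set \<Rightarrow> ('a word \<times> 'a word) set \<Rightarrow> 'a word set monoid" where
  "pres_group X R =
    \<lparr>carrier = words X // pres_rel X R,
     mult = (\<lambda>A B. \<Union>a\<in>A. \<Union>b\<in>B. pres_rel X R `` {a @ b}),
     one = pres_rel X R `` {[]}\<rparr>"

definition pres_gen :: "'a set \<Rightarrow> ('a word \<times> 'a word) set \<Rightarrow> 'a \<Rightarrow> 'a word set" where
  "pres_gen X R x = pres_rel X R `` {[(x, True)]}"

text \<open>\<open>G\<close> has the presentation with generators \<open>X\<close> and relations \<open>R\<close>, where the generator
  \<open>x\<close> is interpreted as the element \<open>f x\<close> of \<open>G\<close>.\<close>

definition has_presentation ::
    "('b, 'c) monoid_scheme \<Rightarrow> 'a set \<Rightarrow> ('a word \<times> 'a word) set \<Rightarrow> ('a \<Rightarrow> 'b) \<Rightarrow> bool" where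
  "has_presentation G X R f \<longleftrightarrow>
    (\<exists>\<phi> \<in> iso (pres_group X R) G. \<forall>x\<in>X. \<phi> (pres_gen X R x) = f x)"

lemma pres_eq_words: "pres_eq X R v w \<Longrightarrow> v \<in> words X \<and> w \<in> words X"
  by (induction rule: pres_eq.induct) (auto simp: words_def)

lemma equiv_pres_rel: "equiv (words X) (pres_rel X R)"
  by (rule equivI)
    (auto simp: pres_rel_def refl_on_def sym_def trans_def dest: pres_eq_words
      intro: pres_eq.refl pres_eq.sym pres_eq.trans)

lemma pres_eq_append_left:
  assumes "pres_eq X R v w" "u \<in> words X"
  shows "pres_eq X R (u @ v) (u @ w)"
  using assms
proof (induction rule: pres_eq.induct)
  case (cancel u' v x b)
  then show ?case using pres_eq.cancel[of "u @ u'" X v x R b] by (auto simp: words_def)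
next
  case (rel u' v l r)
  then show ?case using pres_eq.rel[of "u @ u'" X v l r R] by (auto simp: words_def)
qed (auto simp: words_def intro: pres_eq.refl pres_eq.sym pres_eq.trans)

lemma pres_eq_append_right:
  assumes "pres_eq X R v w" "u \<in> words X"
  shows "pres_eq X R (v @ u) (w @ u)"
  using assms
proof (induction rule: pres_eq.induct)
  case (cancel u' v x b)
  then show ?case using pres_eq.cancel[of u' X "v @ u" x R b] by (auto simp: words_def)
next
  case (rel u' v l r)
  then show ?case using pres_eq.rel[of u' X "v @ u" l r R] by (auto simp: words_def)
qed (auto simp: words_def intro: pres_eq.refl pres_eq.sym pres_eq.trans)

lemma pres_eq_append:
  "pres_eq X R v w \<Longrightarrow> pres_eq X R v' w' \<Longrightarrow> pres_eq X R (v @ v') (w @ w')"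
  by (meson pres_eq.trans pres_eq_append_left pres_eq_append_right pres_eq_words)

lemma mult_pres_group:
  assumes "v \<in> words X" "w \<in> words X"
  shows "pres_rel X R `` {v} \<otimes>\<^bsub>pres_group X R\<^esub> pres_rel X R `` {w} = pres_rel X R `` {v @ w}"
  unfolding pres_group_def monoid.simps pres_rel_def
  using assms
  by (auto intro: pres_eq.refl pres_eq.trans pres_eq_append)

lemma pres_eq_inverse:
  "w \<in> words X \<Longrightarrow> pres_eq X R (rev (map (\<lambda>(x, b). (x, \<not> b)) w) @ w) []"
proof (induction w)
  case Nil
  then show ?case by (auto simp: words_def intro: pres_eq.refl)
next
  case (Cons a w)
  obtain x b where a: "a = (x, b)" by fastforce
  let ?i = "rev (map (\<lambda>(x, b). (x, \<not> b)) w)"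
  have w: "w \<in> words X" and x: "x \<in> X" using Cons.prems a by (auto simp: words_def)
  have i: "?i \<in> words X" using w by (auto simp: words_def in_lists_conv_set)
  have "pres_eq X R (?i @ [(x, \<not> b), (x, \<not> \<not> b)] @ w) (?i @ w)"
    using i w x by (rule pres_eq.cancel)
  then show ?case using Cons.IH[OF w] a by (auto intro: pres_eq.trans)
qed

lemma group_pres_group: "group (pres_group X R)"
proof (rule groupI)
  let ?G = "pres_group X R" and ?c = "\<lambda>w. pres_rel X R `` {w}"
  have C: "carrier ?G = ?c ` words X" and O: "\<one>\<^bsub>?G\<^esub> = ?c []"
    by (auto simp: pres_group_def quotient_def)
  have app: "v @ w \<in> words X" if "v \<in> words X" "w \<in> words X" for v w :: "'a word"
    using that by (auto simp: words_def)
  have nil: "[] \<in> words X" by (auto simp: words_def)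
  show "x \<otimes>\<^bsub>?G\<^esub> y \<in> carrier ?G" if "x \<in> carrier ?G" "y \<in> carrier ?G" for x y
    using that by (auto simp: C mult_pres_group app)
  show "\<one>\<^bsub>?G\<^esub> \<in> carrier ?G" using nil by (auto simp: C O)
  show "x \<otimes>\<^bsub>?G\<^esub> y \<otimes>\<^bsub>?G\<^esub> z = x \<otimes>\<^bsub>?G\<^esub> (y \<otimes>\<^bsub>?G\<^esub> z)"
    if "x \<in> carrier ?G" "y \<in> carrier ?G" "z \<in> carrier ?G" for x y z
    using that by (auto simp: C mult_pres_group app)
  show "\<one>\<^bsub>?G\<^esub> \<otimes>\<^bsub>?G\<^esub> x = x" if "x \<in> carrier ?G" for x
    using that by (auto simp: C O mult_pres_group nil)
  show "\<exists>y\<in>carrier ?G. y \<otimes>\<^bsub>?G\<^esub> x = \<one>\<^bsub>?G\<^esub>" if x: "x \<in> carrier ?G" for x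
  proof -
    obtain w where w: "w \<in> words X" "x = ?c w" using x unfolding C by auto
    let ?i = "rev (map (\<lambda>(x, b). (x, \<not> b)) w)"
    have i: "?i \<in> words X" using w by (auto simp: words_def in_lists_conv_set)
    have "?c (?i @ w) = ?c []"
      by (rule equiv_class_eq[OF equiv_pres_rel]) (simp add: pres_rel_def pres_eq_inverse w(1))
    then have "?c ?i \<otimes>\<^bsub>?G\<^esub> x = \<one>\<^bsub>?G\<^esub>" using mult_pres_group[OF i w(1)] w O by simp
    then show ?thesis using i C by auto
  qed
qed

section \<open>Normal closure\<close>

definition normal_closure :: "('a, 'b) monoid_scheme \<Rightarrow> 'a set \<Rightarrow> 'a set" where
  "normal_closure G S = \<Inter>{N. N \<lhd> G \<and> S \<subseteq> N}"

lemma (in group) normal_closure_normal: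
  assumes "S \<subseteq> carrier G"
  shows "normal_closure G S \<lhd> G"
proof -
  have "carrier G \<lhd> G" using normal_inv_iff subgroup_self by auto
  then have ne: "{N. N \<lhd> G \<and> S \<subseteq> N} \<noteq> {}" using assms by auto
  have "subgroup (normal_closure G S) G"
    unfolding normal_closure_def using ne by (intro subgroups_Inter) (auto intro: normal_imp_subgroup)
  then show ?thesis
    unfolding normal_inv_iff by (auto simp: normal_closure_def normal_inv_iff)
qed

section \<open>\<open>J\<close>-groups\<close>

datatype J_letter = Gs | Gt | Gu

definition J_rels :: "nat \<Rightarrow> nat \<Rightarrow> nat \<Rightarrow> (J_letter word \<times> J_letter word) set" where
  "J_rels a b c =
    {(pos (replicate a Gs), []), (pos (replicate b Gt), []), (pos (replicate c Gu), []),
     (pos [Gs, Gt, Gu], pos [Gt, Gu, Gs]), (pos [Gt, Gu, Gs], pos [Gu, Gs, Gt])}"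

definition J_group :: "nat \<Rightarrow> nat \<Rightarrow> nat \<Rightarrow> J_letter word set monoid" where
  "J_group a b c = pres_group UNIV (J_rels a b c)"

definition J_gen :: "nat \<Rightarrow> nat \<Rightarrow> nat \<Rightarrow> J_letter \<Rightarrow> J_letter word set" where
  "J_gen a b c = pres_gen UNIV (J_rels a b c)"

text \<open>Meant for \<open>a, b, c \<ge> 2\<close> and pairwise coprime positive divisors \<open>a'\<close>, \<open>b'\<close>, \<open>c'\<close> of
  \<open>a\<close>, \<open>b\<close>, \<open>c\<close>. This is the underlying set of the subgroup.\<close>

definition J_sub :: "nat \<Rightarrow> nat \<Rightarrow> nat \<Rightarrow> nat \<Rightarrow> nat \<Rightarrow> nat \<Rightarrow> J_letter word set set" where
  "J_sub a b c a' b' c' =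
    normal_closure (J_group a b c)
      {J_gen a b c Gs [^]\<^bsub>J_group a b c\<^esub> a',
       J_gen a b c Gt [^]\<^bsub>J_group a b c\<^esub> b',
       J_gen a b c Gu [^]\<^bsub>J_group a b c\<^esub> c'}"

lemma group_J_group: "group (J_group a b c)"
  unfolding J_group_def by (rule group_pres_group)

lemma J_gen_closed: "J_gen a b c g \<in> carrier (J_group a b c)"
  by (auto simp: J_gen_def J_group_def pres_gen_def pres_group_def words_def intro!: quotientI)

lemma J_sub_normal: "J_sub a b c a' b' c' \<lhd> J_group a b c"
proof -
  interpret group "J_group a b c" by (rule group_J_group)
  show ?thesis
    unfolding J_sub_def by (rule normal_closure_normal) (auto intro: J_gen_closed)
qed

section \<open>Toric reflection groups\<close>

text \<open>The generators \<open>x\<^sub>1, \<dots>, x\<^sub>n\<close> are represented by the numbers \<open>1, \<dots>, n\<close>, and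
  \<open>cyc_word n m i\<close> is \<open>x\<^sub>i x\<^sub>i\<^sub>+\<^sub>1 \<dots> x\<^sub>i\<^sub>+\<^sub>m\<^sub>-\<^sub>1\<close> for \<open>i \<ge> 1\<close>: an index \<open>j \<ge> 1\<close> is reduced modulo \<open>n\<close>
  to its representative \<open>(j - 1) mod n + 1\<close> in \<open>{1..n}\<close>.\<close>

definition cyc_word :: "nat \<Rightarrow> nat \<Rightarrow> nat \<Rightarrow> nat word" where
  "cyc_word n m i = pos (map (\<lambda>j. (j - 1) mod n + 1) [i..<i + m])"

definition power_rels :: "nat \<Rightarrow> nat \<Rightarrow> (nat word \<times> nat word) set" where
  "power_rels k n = {(pos (replicate k i), []) | i. i \<in> {1..n}}"

text \<open>Meant for \<open>k, n, m \<ge> 2\<close> with \<open>n < m\<close> coprime.\<close>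

definition toric_group :: "nat \<Rightarrow> nat \<Rightarrow> nat \<Rightarrow> nat word set monoid" where
  "toric_group k n m =
    pres_group {1..n}
      (power_rels k n \<union> {(cyc_word n m i, cyc_word n m j) | i j. i \<in> {1..n} \<and> j \<in> {1..n}})"

end

theory Submission
  imports Defs "HOL-Algebra.Bij"
begin

text \<open>Let \<open>K\<close> be the group presented by the \<open>x\<^sub>i\<close>. In \<open>G\<close> the element \<open>z = stu\<close> is central and
  \<open>(st)\<^sup>m = z\<^sup>m\<close>, so with \<open>x\<^sub>i = t\<^sup>i\<^sup>-\<^sup>1 s t\<^sup>1\<^sup>-\<^sup>i\<close> every word \<open>x\<^sub>i \<cdots> x\<^sub>i\<^sub>+\<^sub>m\<^sub>-\<^sub>1\<close> equals \<open>z\<^sup>m t\<^sup>-\<^sup>m\<close>, which gives a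
  homomorphism from \<open>K\<close> to \<open>G\<close>; its image is normal and hence equal to \<open>H\<close>. For injectivity, let
  \<open>\<sigma>\<close> be the automorphism \<open>x\<^sub>i \<mapsto> x\<^sub>i\<^sub>+\<^sub>1\<close> of \<open>K\<close> and \<open>\<Delta> = x\<^sub>1 \<cdots> x\<^sub>m\<close>, which \<open>\<sigma>\<close> fixes and which satisfies
  \<open>\<Delta> \<sigma>\<^sup>m(g) = g \<Delta>\<close>. Then \<open>G\<close> acts on \<open>K \<times> {0, \<dots>, m - 1}\<close>: \<open>s\<close> multiplies by \<open>x\<^sub>1\<close> on the left,
  \<open>t\<close> applies \<open>\<sigma>\<close>, and \<open>z\<close> increases the second component, with a carry that multiplies by \<open>\<Delta>\<close> on the
  right. This is the action on the cosets of \<open>\<langle>t\<rangle>\<close>. Restricted along \<open>K \<rightarrow> G\<close> it is left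
  multiplication, which is faithful.\<close>

section \<open>Values of words and maps out of presented groups\<close>

primrec word_val :: "('b, 'c) monoid_scheme \<Rightarrow> ('a \<Rightarrow> 'b) \<Rightarrow> 'a word \<Rightarrow> 'b" where
  "word_val G f [] = \<one>\<^bsub>G\<^esub>"
| "word_val G f (p # w) =
    (if snd p then f (fst p) else inv\<^bsub>G\<^esub> f (fst p)) \<otimes>\<^bsub>G\<^esub> word_val G f w"

lemma words_simps [simp]:
  "[] \<in> words X"
  "p # w \<in> words X \<longleftrightarrow> fst p \<in> X \<and> w \<in> words X"
  "v @ w \<in> words X \<longleftrightarrow> v \<in> words X \<and> w \<in> words X"
  by (auto simp: words_def mem_Times_iff)

lemma pos_simps [simp]:
  "pos [] = []"
  "pos (x # xs) = (x, True) # pos xs"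
  "pos (xs @ ys) = pos xs @ pos ys"
  by (auto simp: pos_def)

lemma pos_in_words: "set xs \<subseteq> X \<Longrightarrow> pos xs \<in> words X"
  by (induction xs) auto

context group
begin

lemma word_val_closed:
  "f \<in> X \<rightarrow> carrier G \<Longrightarrow> w \<in> words X \<Longrightarrow> word_val G f w \<in> carrier G"
  by (induction w) auto

lemma word_val_append:
  assumes "f \<in> X \<rightarrow> carrier G" "v \<in> words X" "w \<in> words X"
  shows "word_val G f (v @ w) = word_val G f v \<otimes> word_val G f w"
  using assms
proof (induction v)
  case (Cons p v)
  moreover have "word_val G f v \<in> carrier G" "word_val G f w \<in> carrier G" "f (fst p) \<in> carrier G"
    using Cons.prems by (auto intro: word_val_closed)
  ultimately show ?case by (auto simp: m_assoc)
qed (auto simp: word_val_closed)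

lemma word_val_replicate:
  assumes "f x \<in> carrier G"
  shows "word_val G f (pos (replicate k x)) = f x [^] k"
  by (induction k) (simp_all add: nat_pow_Suc2[OF assms, symmetric] del: nat_pow_Suc)

text \<open>Soundness of evaluation: cancelling pairs and relators may sit inside any context, and
  \<open>word_val_append\<close> strips that context off. This makes evaluation well defined on
  classes of words.\<close>

lemma word_val_pres_eq:
  assumes "pres_eq X R v w" and f: "f \<in> X \<rightarrow> carrier G"
    and "\<And>l r. (l, r) \<in> R \<Longrightarrow> l \<in> words X \<Longrightarrow> r \<in> words X \<Longrightarrow> word_val G f l = word_val G f r"
  shows "word_val G f v = word_val G f w"
  using assms(1)
proof induction
  case (cancel u v x b)
  then have "f x \<in> carrier G" "word_val G f v \<in> carrier G" "word_val G f u \<in> carrier G"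
    using f by (auto intro: word_val_closed)
  then have "word_val G f ([(x, b), (x, \<not> b)] @ v) = word_val G f v"
    by (cases b) (auto simp: m_assoc[symmetric])
  then show ?case
    using cancel word_val_append[OF f] by simp
next
  case (rel u v l r)
  then show ?case
    using assms(3) by (simp add: word_val_append[OF f])
qed auto

end

lemma carrier_pres_group: "carrier (pres_group X R) = (\<lambda>w. pres_rel X R `` {w}) ` words X"
  by (auto simp: pres_group_def quotient_def)

lemma one_pres_group: "\<one>\<^bsub>pres_group X R\<^esub> = pres_rel X R `` {[]}"
  by (simp add: pres_group_def)

lemma pres_class_eq_iff:
  "v \<in> words X \<Longrightarrow> w \<in> words X \<Longrightarrow>
    pres_rel X R `` {v} = pres_rel X R `` {w} \<longleftrightarrow> pres_eq X R v w"
  using eq_equiv_class_iff[OF equiv_pres_rel] by (fastforce simp: pres_rel_def)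

lemma pres_gen_closed: "x \<in> X \<Longrightarrow> pres_gen X R x \<in> carrier (pres_group X R)"
  by (auto simp: pres_gen_def carrier_pres_group)

lemma inv_pres_gen:
  assumes "x \<in> X"
  shows "inv\<^bsub>pres_group X R\<^esub> pres_gen X R x = pres_rel X R `` {[(x, False)]}"
proof -
  interpret group "pres_group X R" by (rule group_pres_group)
  have "pres_eq X R ([] @ [(x, False), (x, \<not> False)] @ []) ([] @ [])"
    using assms by (intro pres_eq.cancel) auto
  then show ?thesis
    using assms unfolding pres_gen_def
    by (intro inv_equality)
      (auto simp: carrier_pres_group mult_pres_group one_pres_group pres_class_eq_iff)
qed

lemma word_val_pres_gen:
  "w \<in> words X \<Longrightarrow> word_val (pres_group X R) (pres_gen X R) w = pres_rel X R `` {w}"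
proof (induction w)
  case Nil
  then show ?case by (simp add: one_pres_group)
next
  case (Cons p w)
  then have "(if snd p then pres_gen X R (fst p) else inv\<^bsub>pres_group X R\<^esub> pres_gen X R (fst p))
      = pres_rel X R `` {[p]}"
    by (cases p) (auto simp: inv_pres_gen, auto simp: pres_gen_def)
  then show ?case using Cons by (simp add: mult_pres_group)
qed

lemma word_val_pres_rel:
  assumes "(l, r) \<in> R" "l \<in> words X" "r \<in> words X"
  shows "word_val (pres_group X R) (pres_gen X R) l = word_val (pres_group X R) (pres_gen X R) r"
  using pres_eq.rel[of "[]" X "[]" l r R] assms by (simp add: word_val_pres_gen pres_class_eq_iff)

text \<open>Von Dyck's theorem, existence part; uniqueness is
  \<open>pres_group_hom_eq\<close>.\<close>

lemma pres_group_universal: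
  assumes "group G" and f: "f \<in> X \<rightarrow> carrier G"
    and rels: "\<And>l r. (l, r) \<in> R \<Longrightarrow> l \<in> words X \<Longrightarrow> r \<in> words X \<Longrightarrow>
      word_val G f l = word_val G f r"
  obtains \<phi> where "\<phi> \<in> hom (pres_group X R) G" "\<And>x. x \<in> X \<Longrightarrow> \<phi> (pres_gen X R x) = f x"
proof -
  interpret group G by fact
  \<comment> \<open>\<open>SOME\<close> picks a word representing the class; by
    \<open>word_val_pres_eq\<close> the value does not depend on the choice.\<close>
  define \<phi> where "\<phi> A = word_val G f (SOME w. w \<in> words X \<and> A = pres_rel X R `` {w})" for A
  have \<phi>: "\<phi> (pres_rel X R `` {w}) = word_val G f w" if w: "w \<in> words X" for w
  proof -
    define v where "v = (SOME v. v \<in> words X \<and> pres_rel X R `` {w} = pres_rel X R `` {v})"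
    have "v \<in> words X \<and> pres_rel X R `` {w} = pres_rel X R `` {v}"
      unfolding v_def using w by (intro someI) auto
    then have "pres_eq X R v w" using w by (auto simp: pres_class_eq_iff intro: pres_eq.sym)
    then show ?thesis unfolding \<phi>_def v_def[symmetric] using f rels by (rule word_val_pres_eq)
  qed
  show ?thesis
  proof
    show "\<phi> \<in> hom (pres_group X R) G"
      by (rule homI)
        (auto simp: carrier_pres_group mult_pres_group \<phi> word_val_append[OF f] word_val_closed[OF f])
    show "\<phi> (pres_gen X R x) = f x" if "x \<in> X" for x
      using that \<phi>[of "[(x, True)]"] funcset_mem[OF f] by (simp add: pres_gen_def)
  qed
qed

lemma pres_group_generate:
  "carrier (pres_group X R) = generate (pres_group X R) (pres_gen X R ` X)"
proof
  interpret group "pres_group X R" by (rule group_pres_group)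
  let ?I = "generate (pres_group X R) (pres_gen X R ` X)"
  have "word_val (pres_group X R) (pres_gen X R) w \<in> ?I" if "w \<in> words X" for w
    using that by (induction w) (auto intro: generate.intros)
  then show "carrier (pres_group X R) \<subseteq> ?I"
    by (auto simp: carrier_pres_group word_val_pres_gen)
  show "?I \<subseteq> carrier (pres_group X R)"
    by (rule generate_incl) (auto simp: pres_gen_closed)
qed

lemma (in group) hom_eq_on_generate:
  assumes "group L" "\<phi> \<in> hom G L" "\<psi> \<in> hom G L" "A \<subseteq> carrier G"
    and "\<And>a. a \<in> A \<Longrightarrow> \<phi> a = \<psi> a" "g \<in> generate G A"
  shows "\<phi> g = \<psi> g"
proof -
  interpret \<phi>: group_hom G L \<phi> by (simp add: assms group_hom_def group_hom_axioms_def)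
  interpret \<psi>: group_hom G L \<psi> by (simp add: assms group_hom_def group_hom_axioms_def)
  show ?thesis
    using assms(6)
  proof induction
    case (inv h)
    then show ?case using assms(4,5) by (auto simp: subset_iff)
  next
    case (eng g h)
    then show ?case using generate_in_carrier[OF assms(4)] by simp
  qed (auto simp: assms)
qed

lemma pres_group_hom_eq:
  assumes "group L" "\<phi> \<in> hom (pres_group X R) L" "\<psi> \<in> hom (pres_group X R) L"
    and "\<And>x. x \<in> X \<Longrightarrow> \<phi> (pres_gen X R x) = \<psi> (pres_gen X R x)" "g \<in> carrier (pres_group X R)"
  shows "\<phi> g = \<psi> g"
  by (rule group.hom_eq_on_generate[OF group_pres_group assms(1-3), of "pres_gen X R ` X" g])
    (use assms(4,5) in \<open>auto simp: pres_gen_closed simp flip: pres_group_generate\<close>)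

text \<open>If each relation set derives the other, both generate the same congruence, so the
  quotients are literally equal and not merely isomorphic.\<close>

lemma pres_group_cong:
  assumes "\<And>l r. (l, r) \<in> R \<Longrightarrow> l \<in> words X \<Longrightarrow> r \<in> words X \<Longrightarrow> pres_eq X R' l r"
    and "\<And>l r. (l, r) \<in> R' \<Longrightarrow> l \<in> words X \<Longrightarrow> r \<in> words X \<Longrightarrow> pres_eq X R l r"
  shows "pres_group X R = pres_group X R'"
proof -
  have "pres_eq X R2 v w"
    if "pres_eq X R1 v w"
      "\<And>l r. (l, r) \<in> R1 \<Longrightarrow> l \<in> words X \<Longrightarrow> r \<in> words X \<Longrightarrow> pres_eq X R2 l r"
    for R1 R2 :: "('a word \<times> 'a word) set" and v w
    using that
  proof induction
    case (rel u v l r)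
    then show ?case by (intro pres_eq_append) (auto intro: pres_eq.refl)
  qed (blast intro: pres_eq.intros)+
  then have "pres_rel X R = pres_rel X R'"
    unfolding pres_rel_def using assms by blast
  then show ?thesis by (simp add: pres_group_def)
qed

section \<open>Cyclic words\<close>

lemma cyc_word_0 [simp]: "cyc_word n 0 i = []"
  by (simp add: cyc_word_def)

lemma cyc_word_Suc:
  "cyc_word n (Suc m) (Suc i) = (i mod n + 1, True) # cyc_word n m (Suc (Suc i))"
  by (simp add: cyc_word_def upt_conv_Cons del: upt_Suc)

lemma cyc_word_snoc:
  "cyc_word n (Suc m) (Suc i) = cyc_word n m (Suc i) @ [((i + m) mod n + 1, True)]"
  by (simp add: cyc_word_def)

text \<open>Allows unbounded start indices, so that shifting needs no case distinction at the
  wrap-around.\<close>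

lemma cyc_word_mod: "cyc_word n m (Suc (i mod n)) = cyc_word n m (Suc i)"
proof (induction m arbitrary: i)
  case (Suc m)
  have "cyc_word n m (Suc (Suc (i mod n))) = cyc_word n m (Suc (Suc i))"
    using Suc.IH[of "Suc (i mod n)"] Suc.IH[of "Suc i"] by (simp add: mod_Suc_eq)
  then show ?case by (simp add: cyc_word_Suc)
qed simp

lemma cyc_word_in_words: "0 < n \<Longrightarrow> cyc_word n m i \<in> words {1..n}"
  unfolding cyc_word_def by (rule pos_in_words) (auto simp: Suc_le_eq)

context group
begin

lemma pow_mod_eq:
  assumes "t \<in> carrier G" "t [^] (n :: nat) = \<one>"
  shows "t [^] (i mod n) = t [^] i"
proof -
  have "t [^] i = t [^] (n * (i div n) + i mod n)" by simp
  also have "\<dots> = (t [^] n) [^] (i div n) \<otimes> t [^] (i mod n)"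
    using assms(1) by (simp only: nat_pow_mult[symmetric] nat_pow_pow)
  finally show ?thesis using assms by simp
qed

text \<open>The product telescopes: between consecutive factors \<open>inv (t [^] i)\<close> meets
  \<open>t [^] Suc i\<close> and leaves a single \<open>t\<close>. Since
  \<open>t [^] n = \<one>\<close>, reducing an index modulo \<open>n\<close> does not change the
  conjugate.\<close>

lemma word_val_cyc_conj:
  assumes st: "s \<in> carrier G" "t \<in> carrier G" and "0 < n" "t [^] n = \<one>"
    and f: "\<And>i. i < n \<Longrightarrow> f (Suc i) = t [^] i \<otimes> s \<otimes> inv (t [^] i)"
  shows "word_val G f (cyc_word n m (Suc i)) = t [^] i \<otimes> (s \<otimes> t) [^] m \<otimes> inv (t [^] (m + i))"
proof (induction m arbitrary: i)
  case (Suc m)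
  let ?p = "(s \<otimes> t) [^] m" and ?q = "inv (t [^] (Suc m + i))"
  have c: "t [^] i \<in> carrier G" "?p \<in> carrier G" "?q \<in> carrier G" using st by auto
  have "f (i mod n + 1) = t [^] i \<otimes> s \<otimes> inv (t [^] i)"
    using f[of "i mod n"] assms by (simp add: pow_mod_eq)
  then have "word_val G f (cyc_word n (Suc m) (Suc i))
      = (t [^] i \<otimes> s \<otimes> inv (t [^] i)) \<otimes> (t [^] i \<otimes> t \<otimes> ?p \<otimes> ?q)"
    by (simp add: cyc_word_Suc Suc)
  also have "\<dots> = t [^] i \<otimes> s \<otimes> (inv (t [^] i) \<otimes> t [^] i) \<otimes> t \<otimes> ?p \<otimes> ?q"
    using st c by (simp only: m_assoc m_closed inv_closed)
  also have "\<dots> = t [^] i \<otimes> (s \<otimes> t \<otimes> ?p) \<otimes> ?q"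
    using st c by (simp add: m_assoc)
  also have "s \<otimes> t \<otimes> ?p = (s \<otimes> t) [^] Suc m"
    using st by (metis m_closed nat_pow_Suc2)
  finally show ?case .
qed (use st in auto)

lemma commutes_inv:
  assumes "x \<otimes> y = y \<otimes> x" "x \<in> carrier G" "y \<in> carrier G"
  shows "inv x \<otimes> y = y \<otimes> inv x"
  by (metis assms inv_closed inv_solve_left m_assoc m_closed inv_solve_right)

lemma commutes_mult:
  assumes "x \<otimes> z = z \<otimes> x" "y \<otimes> z = z \<otimes> y"
    "x \<in> carrier G" "y \<in> carrier G" "z \<in> carrier G"
  shows "x \<otimes> y \<otimes> z = z \<otimes> (x \<otimes> y)"
  by (metis assms m_assoc)

end

section \<open>The groups \<open>J(a,b,c)\<close>\<close>

lemma J_gen_relations: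
  fixes a b c :: nat
  defines "G \<equiv> J_group a b c" and "s \<equiv> J_gen a b c Gs" and "t \<equiv> J_gen a b c Gt"
    and "u \<equiv> J_gen a b c Gu"
  shows "s [^]\<^bsub>G\<^esub> a = \<one>\<^bsub>G\<^esub>" "t [^]\<^bsub>G\<^esub> b = \<one>\<^bsub>G\<^esub>" "u [^]\<^bsub>G\<^esub> c = \<one>\<^bsub>G\<^esub>"
    "s \<otimes>\<^bsub>G\<^esub> t \<otimes>\<^bsub>G\<^esub> u = t \<otimes>\<^bsub>G\<^esub> u \<otimes>\<^bsub>G\<^esub> s" "t \<otimes>\<^bsub>G\<^esub> u \<otimes>\<^bsub>G\<^esub> s = u \<otimes>\<^bsub>G\<^esub> s \<otimes>\<^bsub>G\<^esub> t"
proof -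
  interpret group G unfolding G_def by (rule group_J_group)
  have closed: "J_gen a b c g \<in> carrier G" for g unfolding G_def by (rule J_gen_closed)
  have rel: "word_val G (J_gen a b c) l = word_val G (J_gen a b c) r"
    if "(l, r) \<in> J_rels a b c" for l r
    using that word_val_pres_rel[of l r "J_rels a b c" UNIV]
    by (simp add: words_def G_def J_group_def J_gen_def)
  show "s [^]\<^bsub>G\<^esub> a = \<one>\<^bsub>G\<^esub>"
    using rel[of "pos (replicate a Gs)" "[]"] closed
    by (simp add: J_rels_def word_val_replicate s_def)
  show "t [^]\<^bsub>G\<^esub> b = \<one>\<^bsub>G\<^esub>"
    using rel[of "pos (replicate b Gt)" "[]"] closed
    by (simp add: J_rels_def word_val_replicate t_def)
  show "u [^]\<^bsub>G\<^esub> c = \<one>\<^bsub>G\<^esub>"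
    using rel[of "pos (replicate c Gu)" "[]"] closed
    by (simp add: J_rels_def word_val_replicate u_def)
  show "s \<otimes>\<^bsub>G\<^esub> t \<otimes>\<^bsub>G\<^esub> u = t \<otimes>\<^bsub>G\<^esub> u \<otimes>\<^bsub>G\<^esub> s"
    using rel[of "pos [Gs, Gt, Gu]" "pos [Gt, Gu, Gs]"] closed
    by (simp add: J_rels_def s_def t_def u_def m_assoc)
  show "t \<otimes>\<^bsub>G\<^esub> u \<otimes>\<^bsub>G\<^esub> s = u \<otimes>\<^bsub>G\<^esub> s \<otimes>\<^bsub>G\<^esub> t"
    using rel[of "pos [Gt, Gu, Gs]" "pos [Gu, Gs, Gt]"] closed
    by (simp add: J_rels_def s_def t_def u_def m_assoc)
qed

lemma UNIV_J_letter: "UNIV = {Gs, Gt, Gu}"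
  using J_letter.exhaust by auto

lemma J_group_generate: "carrier (J_group a b c) = generate (J_group a b c) (range (J_gen a b c))"
  unfolding J_group_def J_gen_def by (rule pres_group_generate)

text \<open>With the central element \<open>z = stu\<close> replacing \<open>u\<close>, the relation \<open>u\<^sup>c = 1\<close>
  becomes \<open>(st)\<^sup>c = z\<^sup>c\<close>.\<close>

lemma J_group_universal:
  assumes "group L" and st: "s \<in> carrier L" "t \<in> carrier L" and z: "z \<in> carrier L"
    and "s [^]\<^bsub>L\<^esub> a = \<one>\<^bsub>L\<^esub>" "t [^]\<^bsub>L\<^esub> b = \<one>\<^bsub>L\<^esub>" "(s \<otimes>\<^bsub>L\<^esub> t) [^]\<^bsub>L\<^esub> c = z [^]\<^bsub>L\<^esub> c"
    and zs: "s \<otimes>\<^bsub>L\<^esub> z = z \<otimes>\<^bsub>L\<^esub> s" and zt: "t \<otimes>\<^bsub>L\<^esub> z = z \<otimes>\<^bsub>L\<^esub> t"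
  obtains \<rho> where "\<rho> \<in> hom (J_group a b c) L" "\<rho> (J_gen a b c Gs) = s" "\<rho> (J_gen a b c Gt) = t"
proof -
  interpret L: group L by fact
  \<comment> \<open>Forced by \<open>stu = z\<close>. As \<open>z\<close> commutes with
    \<open>s\<close> and \<open>t\<close>, all three cyclic products of \<open>s\<close>,
    \<open>t\<close>, \<open>u\<close> equal \<open>z\<close>, and powers of \<open>u\<close> split
    into powers of \<open>inv (st)\<close> and \<open>z\<close>.\<close>
  define u where "u = inv\<^bsub>L\<^esub> (s \<otimes>\<^bsub>L\<^esub> t) \<otimes>\<^bsub>L\<^esub> z"
  define F where "F = case_J_letter s t u"
  have u: "u \<in> carrier L" using st z by (simp add: u_def)
  have F: "F \<in> UNIV \<rightarrow> carrier L"
    using st u by (auto simp: F_def split: J_letter.split)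
  have Fv: "F Gs = s" "F Gt = t" "F Gu = u" by (auto simp: F_def)
  have zi: "inv\<^bsub>L\<^esub> (s \<otimes>\<^bsub>L\<^esub> t) \<otimes>\<^bsub>L\<^esub> z = z \<otimes>\<^bsub>L\<^esub> inv\<^bsub>L\<^esub> (s \<otimes>\<^bsub>L\<^esub> t)"
    using st z zs zt by (intro L.commutes_inv L.commutes_mult) auto
  have "u [^]\<^bsub>L\<^esub> c = inv\<^bsub>L\<^esub> (s \<otimes>\<^bsub>L\<^esub> t) [^]\<^bsub>L\<^esub> c \<otimes>\<^bsub>L\<^esub> z [^]\<^bsub>L\<^esub> c"
    unfolding u_def using st z zi by (intro L.pow_mult_distrib) auto
  then have uc: "u [^]\<^bsub>L\<^esub> c = \<one>\<^bsub>L\<^esub>"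
    using st z assms(7) by (simp add: L.nat_pow_inv)
  have stu: "s \<otimes>\<^bsub>L\<^esub> (t \<otimes>\<^bsub>L\<^esub> u) = z"
    using st z by (simp add: u_def L.m_assoc[symmetric])
  have ust: "u \<otimes>\<^bsub>L\<^esub> (s \<otimes>\<^bsub>L\<^esub> t) = z"
    using st z unfolding u_def zi by (simp add: L.m_assoc)
  have "t \<otimes>\<^bsub>L\<^esub> u = inv\<^bsub>L\<^esub> s \<otimes>\<^bsub>L\<^esub> z"
    using stu st u z by (metis L.inv_solve_left L.m_closed)
  then have tus: "t \<otimes>\<^bsub>L\<^esub> (u \<otimes>\<^bsub>L\<^esub> s) = z"
    using st z u zs by (simp add: L.m_assoc[symmetric])
      (metis L.inv_solve_left L.m_assoc L.m_closed L.inv_closed)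
  have "word_val L F l = word_val L F r" if "(l, r) \<in> J_rels a b c" for l r
    using that st z u assms(5,6) uc stu ust tus
    by (auto simp: J_rels_def Fv L.word_val_replicate)
  then obtain \<rho> where "\<rho> \<in> hom (J_group a b c) L" "\<And>g. \<rho> (J_gen a b c g) = F g"
    using pres_group_universal[OF assms(1) F, of "J_rels a b c"]
    unfolding J_group_def J_gen_def by (metis UNIV_I)
  then show ?thesis using that Fv by simp
qed

section \<open>The normal closure as a subgroup generated by conjugates\<close>

lemma (in group) normal_closure_eqI:
  assumes "N \<lhd> G" "S \<subseteq> N" "\<And>M. M \<lhd> G \<Longrightarrow> S \<subseteq> M \<Longrightarrow> N \<subseteq> M"
  shows "normal_closure G S = N"
  using assms unfolding normal_closure_def by blast

text \<open>The conjugates of \<open>s\<close> by powers of \<open>t\<close> already generate a normal subgroup: \<open>t\<close> permutes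
  them, and \<open>u\<close> acts on them like \<open>(st)\<^sup>-\<^sup>1\<close>, because \<open>stu\<close> is central.\<close>

lemma (in group) normal_closure_generate_conj:
  fixes k n m :: nat
  assumes gen: "carrier G = generate G {s, t, u}" and pos: "0 < k" "0 < n" "0 < m"
    and rels: "s [^] k = \<one>" "t [^] n = \<one>" "u [^] m = \<one>"
      "s \<otimes> t \<otimes> u = t \<otimes> u \<otimes> s" "t \<otimes> u \<otimes> s = u \<otimes> s \<otimes> t"
    and closed [simp]: "s \<in> carrier G" "t \<in> carrier G" "u \<in> carrier G"
  shows "normal_closure G {s [^] (1 :: nat), t [^] n, u [^] m} =
    generate G ((\<lambda>j. t [^] j \<otimes> s \<otimes> inv (t [^] j)) ` {..<n})"
proof -
  define x where "x j = t [^] j \<otimes> s \<otimes> inv (t [^] j)" for j :: nat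
  let ?I = "generate G (x ` {..<n})"
  have x_closed [simp]: "x j \<in> carrier G" for j by (simp add: x_def)
  have I: "subgroup ?I G" by (rule generate_is_subgroup) auto
  have I_carrier: "h \<in> carrier G" if "h \<in> ?I" for h
    using subgroup.mem_carrier[OF I that] .
  have x_I: "x j \<in> ?I" for j
  proof -
    have "x j = x (j mod n)" using rels(2) by (simp add: x_def pow_mod_eq)
    then show ?thesis using pos by (auto intro: generate.incl)
  qed
  have s_I: "s \<in> ?I" using x_I[of 0] by (simp add: x_def)

  \<comment> \<open>\<open>P\<close> demands only an inclusion under conjugation, so it passes to
    products but not directly to inverses. \<open>P_inv\<close> obtains these from finite order,
    where the inverse is a power.\<close>
  define P where "P g \<longleftrightarrow> g \<in> carrier G \<and> (\<forall>h\<in>?I. g \<otimes> h \<otimes> inv g \<in> ?I)" for g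
  have P_one: "P \<one>" using I_carrier by (simp add: P_def)
  have P_mult: "P (g \<otimes> h)" if "P g" "P h" for g h
  proof -
    have "g \<otimes> h \<otimes> i \<otimes> inv (g \<otimes> h) = g \<otimes> (h \<otimes> i \<otimes> inv h) \<otimes> inv g" if "i \<in> ?I" for i
      using \<open>P g\<close> \<open>P h\<close> I_carrier[OF that] by (simp add: P_def inv_mult_group m_assoc)
    then show ?thesis using that by (auto simp: P_def)
  qed
  have P_pow: "P (g [^] j)" if "P g" for g and j :: nat
    by (induction j) (auto simp: P_one P_mult that)
  have P_inv: "P (inv g)" if "P g" "g [^] r = \<one>" "0 < r" for g and r :: nat
  proof -
    have "g [^] (r - 1) \<otimes> g = \<one>"
      using that by (metis Suc_diff_1 nat_pow_Suc)
    then have "inv g = g [^] (r - 1)"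
      using that by (intro inv_equality) (auto simp: P_def)
    then show ?thesis using P_pow[OF that(1)] by simp
  qed
  have P_I: "P g" if "g \<in> ?I" for g
    using that I I_carrier by (auto simp: P_def subgroup.m_closed subgroup.m_inv_closed)
  have P_t: "P t"
  proof -
    have "t \<otimes> h \<otimes> inv t \<in> ?I" if "h \<in> ?I" for h
      using that
    proof induction
      case one
      then show ?case by (simp add: generate.one)
    next
      case (incl h)
      then obtain j where j: "h = x j" by auto
      \<comment> \<open>For \<open>j = n - 1\<close> the new index leaves \<open>{..<n}\<close>;
        \<open>x_I\<close> holds for every index because \<open>t [^] n = \<one>\<close>.\<close>
      have "t \<otimes> h \<otimes> inv t = x (Suc j)"
        unfolding j x_def nat_pow_Suc2[OF closed(2)] by (simp add: inv_mult_group m_assoc)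
      then show ?case using x_I by simp
    next
      case (inv h)
      then obtain j where j: "h = x j" by auto
      have "t \<otimes> inv h \<otimes> inv t = inv (x (Suc j))"
        unfolding j x_def nat_pow_Suc2[OF closed(2)] by (simp add: inv_mult_group m_assoc)
      then show ?case using x_I subgroup.m_inv_closed[OF I] by simp
    next
      case (eng g h)
      then have "t \<otimes> (g \<otimes> h) \<otimes> inv t = (t \<otimes> g \<otimes> inv t) \<otimes> (t \<otimes> h \<otimes> inv t)"
        using I_carrier by (simp add: m_assoc inv_solve_left)
      then show ?case using eng by (simp add: generate.eng)
    qed
    then show ?thesis by (simp add: P_def)
  qed
  define z where "z = s \<otimes> t \<otimes> u"
  have z_closed: "z \<in> carrier G" by (simp add: z_def)
  have zs: "z \<otimes> s = s \<otimes> z" unfolding z_def using rels(4) by (metis closed m_assoc m_closed)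
  have zt: "z \<otimes> t = t \<otimes> z" unfolding z_def using rels(4,5) by (metis closed m_assoc m_closed)
  have zt_pow: "z \<otimes> t [^] j = t [^] j \<otimes> z" for j :: nat
    using group_commutes_pow[of t z j] zt z_closed by simp
  have zx: "z \<otimes> x j = x j \<otimes> z" for j
    unfolding x_def using zt_pow[of j] zs z_closed
    by (intro commutes_mult[symmetric] commutes_mult commutes_inv) (simp_all flip: zt_pow)
  have P_z: "P z"
  proof -
    have "z \<otimes> h = h \<otimes> z" if "h \<in> ?I" for h
      using that
    proof induction
      case one
      then show ?case using z_closed by simp
    next
      case (incl h)
      then show ?case using zx by auto
    next
      case (inv h)
      then show ?case using commutes_inv[OF zx[symmetric] _ z_closed] by auto
    next
      case (eng g h)
      then show ?case
        using I_carrier z_closed by (intro commutes_mult[symmetric]) auto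
    qed
    then show ?thesis
      using z_closed I_carrier by (auto simp: P_def m_assoc)
  qed
  \<comment> \<open>Solving \<open>z = stu\<close> for \<open>u\<close> reduces \<open>P u\<close>
    to \<open>P z\<close> and to the inverses of \<open>s\<close> and \<open>t\<close>, which have
    finite order.\<close>
  have "u = inv t \<otimes> (inv s \<otimes> z)" unfolding z_def by (simp add: m_assoc[symmetric])
  then have P_u: "P u"
    using P_mult P_inv[OF P_t rels(2)] P_inv[OF P_I[OF s_I] rels(1)] P_z pos by simp
  have P_gen: "P g \<and> P (inv g)" if "g \<in> {s, t, u}" for g
    using that P_I[OF s_I] P_t P_u rels(1-3) pos P_inv by auto
  have "P g" if "g \<in> carrier G" for g
    using that unfolding gen by induction (auto simp: P_one P_gen P_mult)
  then have normal: "?I \<lhd> G" using I by (auto simp: normal_inv_iff P_def)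
  show ?thesis
    unfolding x_def[symmetric]
  proof (rule normal_closure_eqI[OF normal])
    \<comment> \<open>Here \<open>t [^] n\<close> and \<open>u [^] m\<close> are
      \<open>\<one>\<close>, while a normal subgroup containing \<open>s\<close> contains all its
      conjugates \<open>x j\<close>.\<close>
    show "{s [^] (1 :: nat), t [^] n, u [^] m} \<subseteq> ?I"
      using s_I rels by (auto simp: generate.one)
    show "?I \<subseteq> M" if "M \<lhd> G" "{s [^] (1 :: nat), t [^] n, u [^] m} \<subseteq> M" for M
      using that by (intro generate_subgroup_incl) (auto simp: normal_inv_iff x_def)
  qed
qed

lemma J_sub_generate:
  fixes k n m :: nat
  defines "G \<equiv> J_group k n m" and "s \<equiv> J_gen k n m Gs" and "t \<equiv> J_gen k n m Gt"
  assumes "0 < k" "0 < n" "0 < m"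
  shows "J_sub k n m 1 n m =
    generate G ((\<lambda>j. t [^]\<^bsub>G\<^esub> j \<otimes>\<^bsub>G\<^esub> s \<otimes>\<^bsub>G\<^esub> inv\<^bsub>G\<^esub> (t [^]\<^bsub>G\<^esub> j)) ` {..<n})"
proof -
  have "range (J_gen k n m) = {J_gen k n m Gs, J_gen k n m Gt, J_gen k n m Gu}"
    unfolding UNIV_J_letter by simp
  then show ?thesis
    unfolding J_sub_def G_def s_def t_def
    using group.normal_closure_generate_conj[OF group_J_group _ assms(4-6) J_gen_relations]
    by (metis J_gen_closed J_group_generate)
qed

section \<open>The action on \<open>K \<times> \<int>/m\<close>\<close>

lemma BijGroup_mult_apply:
  "f \<in> carrier (BijGroup S) \<Longrightarrow> g \<in> carrier (BijGroup S) \<Longrightarrow> p \<in> S \<Longrightarrow>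
    (f \<otimes>\<^bsub>BijGroup S\<^esub> g) p = f (g p)"
  by (simp add: BijGroup_def compose_def)

lemma BijGroup_apply_closed: "f \<in> carrier (BijGroup S) \<Longrightarrow> p \<in> S \<Longrightarrow> f p \<in> S"
  by (auto simp: BijGroup_def dest: Bij_imp_funcset)

text \<open>Elements of \<open>BijGroup S\<close> are extensional, so their values on
  \<open>S\<close> determine them; this is also why the actions below are restricted to
  \<open>S\<close>.\<close>

lemma BijGroup_eqI:
  "f \<in> carrier (BijGroup S) \<Longrightarrow> g \<in> carrier (BijGroup S) \<Longrightarrow> (\<And>p. p \<in> S \<Longrightarrow> f p = g p) \<Longrightarrow> f = g"
  by (auto simp: BijGroup_def Bij_def intro: extensionalityI)

lemma BijGroup_pow_apply:
  assumes "f \<in> carrier (BijGroup S)" "p \<in> S"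
  shows "(f [^]\<^bsub>BijGroup S\<^esub> (j :: nat)) p = (f ^^ j) p"
  using assms(2)
proof (induction j arbitrary: p)
  case 0
  then show ?case by (simp add: BijGroup_def)
next
  case (Suc j)
  interpret group "BijGroup S" by (rule group_BijGroup)
  show ?case
    using Suc assms(1)
    by (simp add: BijGroup_mult_apply BijGroup_apply_closed funpow_swap1)
qed

lemma restrict_in_BijGroup: "bij_betw f S S \<Longrightarrow> restrict f S \<in> carrier (BijGroup S)"
  by (simp add: BijGroup_def Bij_def cong: bij_betw_cong)

section \<open>The presented group \<open>K\<close> and its element \<Delta>\<close>

definition cyc_rels :: "nat \<Rightarrow> nat \<Rightarrow> nat \<Rightarrow> (nat word \<times> nat word) set" where
  "cyc_rels k n m = power_rels k n \<union> {(cyc_word n m 1, cyc_word n m i) | i. i \<in> {2..n}}"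

text \<open>The bounds on \<open>i\<close> are dropped because the evaluations below hold for every
  index; \<open>Suc i\<close> matches the form of \<open>cyc_word_Suc\<close>.\<close>

lemma cyc_rels_cases:
  assumes "(l, r) \<in> cyc_rels k n m"
  obtains (power) i where "l = pos (replicate k i)" "r = []"
    | (cyc) i where "l = cyc_word n m (Suc 0)" "r = cyc_word n m (Suc i)"
proof -
  have "(\<exists>i. l = pos (replicate k i) \<and> r = []) \<or>
      (\<exists>i\<ge>2. l = cyc_word n m (Suc 0) \<and> r = cyc_word n m i)"
    using assms by (auto simp: cyc_rels_def power_rels_def)
  then show ?thesis using that by (metis Suc_diff_1 less_le_trans zero_less_numeral)
qed

locale cyclic_presentation =
  fixes k n m :: nat and K (structure)
  defines "K \<equiv> pres_group {1..n} (cyc_rels k n m)"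
  assumes n_pos: "0 < n" and m_pos: "0 < m"
begin

sublocale group K
  unfolding K_def by (rule group_pres_group)

definition gen where "gen = pres_gen {1..n} (cyc_rels k n m)"

text \<open>Zero-based and defined for all indices: \<open>y j\<close> is \<open>x\<^sub>j\<^sub>+\<^sub>1\<close>.\<close>

definition y where "y j = gen (j mod n + 1)"

definition \<Delta> where "\<Delta> = word_val K gen (cyc_word n m 1)"

lemma gen_closed: "gen \<in> {1..n} \<rightarrow> carrier K"
  unfolding K_def gen_def by (auto intro: pres_gen_closed)

lemma y_closed [simp]: "y j \<in> carrier K"
  using gen_closed n_pos by (auto simp: y_def Pi_iff Suc_le_eq)

lemma gen_y: "1 \<le> i \<Longrightarrow> i \<le> n \<Longrightarrow> gen i = y (i - 1)"
  by (simp add: y_def)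

lemma \<Delta>_closed [simp]: "\<Delta> \<in> carrier K"
  unfolding \<Delta>_def using n_pos by (intro word_val_closed[OF gen_closed] cyc_word_in_words)

lemma hom_eq:
  "group L \<Longrightarrow> \<phi> \<in> hom K L \<Longrightarrow> \<psi> \<in> hom K L \<Longrightarrow> (\<And>j. \<phi> (y j) = \<psi> (y j)) \<Longrightarrow> g \<in> carrier K \<Longrightarrow>
    \<phi> g = \<psi> g"
  unfolding K_def
  by (erule pres_group_hom_eq) (simp_all add: gen_y flip: gen_def del: One_nat_def)

lemma y_pow: "y j [^] k = \<one>"
proof -
  have "j mod n + 1 \<in> {1..n}" using n_pos by (auto simp: Suc_le_eq)
  then have "word_val K gen (pos (replicate k (j mod n + 1))) = word_val K gen []"
    unfolding K_def gen_def
    by (intro word_val_pres_rel) (auto simp: cyc_rels_def power_rels_def intro!: pos_in_words)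
  then show ?thesis
    using y_closed[of j] by (simp add: word_val_replicate y_def)
qed

lemma cyc_word_\<Delta>: "word_val K gen (cyc_word n m (Suc i)) = \<Delta>"
proof -
  have "word_val K gen (cyc_word n m (Suc (i mod n))) = \<Delta>"
  proof (cases "i mod n = 0")
    case False
    then have "(cyc_word n m 1, cyc_word n m (Suc (i mod n))) \<in> cyc_rels k n m"
      using n_pos by (fastforce simp: cyc_rels_def Suc_le_eq)
    then show ?thesis
      unfolding \<Delta>_def K_def gen_def using n_pos
      by (intro word_val_pres_rel[symmetric] cyc_word_in_words)
  qed (simp add: \<Delta>_def)
  then show ?thesis by (simp add: cyc_word_mod)
qed

text \<open>The cyclic word of length \<open>m + 1\<close> can be split after its first or before
  its last letter, and the remaining \<open>m\<close> letters have value \<Delta> in both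
  cases.\<close>

lemma y_\<Delta>: "y i \<otimes> \<Delta> = \<Delta> \<otimes> y (i + m)"
proof -
  have "y i \<otimes> \<Delta> = word_val K gen (cyc_word n (Suc m) (Suc i))"
    by (simp add: cyc_word_Suc cyc_word_\<Delta> y_def)
  also have "\<dots> = \<Delta> \<otimes> y (i + m)"
    unfolding cyc_word_snoc using n_pos y_closed[of "i + m"]
    by (subst word_val_append[OF gen_closed cyc_word_in_words])
      (simp_all add: cyc_word_\<Delta> y_def Suc_le_eq)
  finally show ?thesis .
qed

section \<open>The shift automorphism and its relation to \<Delta>\<close>

lemma shift_exists: "\<exists>\<sigma>. \<sigma> \<in> hom K K \<and> (\<forall>j. \<sigma> (y j) = y (Suc j))"
proof -
  \<comment> \<open>Generators are numbered from 1 and \<open>y\<close> from 0, so \<open>y\<close>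
    used as an assignment is already the shift: it sends generator \<open>i\<close> to the one after
    it. Each cyclic word then takes the value of the next one, again \<Delta>.\<close>
  have shift: "word_val K y (cyc_word n l (Suc i)) = word_val K gen (cyc_word n l (Suc (Suc i)))" for l i
    by (induction l arbitrary: i) (auto simp: cyc_word_Suc y_def mod_Suc_eq)
  have "word_val K y l = word_val K y r" if "(l, r) \<in> cyc_rels k n m" for l r
    using that
    by (cases rule: cyc_rels_cases) (simp_all add: word_val_replicate y_pow shift cyc_word_\<Delta>)
  moreover have "y \<in> {1..n} \<rightarrow> carrier K" by simp
  ultimately obtain \<sigma> where "\<sigma> \<in> hom (pres_group {1..n} (cyc_rels k n m)) K"
    and "\<And>x. x \<in> {1..n} \<Longrightarrow> \<sigma> (pres_gen {1..n} (cyc_rels k n m) x) = y x"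
    using pres_group_universal[OF group_axioms] by metis
  then have \<sigma>: "\<sigma> \<in> hom K K" "\<And>x. x \<in> {1..n} \<Longrightarrow> \<sigma> (gen x) = y x"
    by (simp_all only: K_def gen_def)
  have "\<sigma> (y j) = y (Suc j)" for j
    using \<sigma>(2)[of "j mod n + 1"] n_pos by (simp add: y_def mod_Suc_eq Suc_le_eq)
  then show ?thesis using \<sigma> by blast
qed

definition \<sigma> where "\<sigma> = (SOME \<sigma>. \<sigma> \<in> hom K K \<and> (\<forall>j. \<sigma> (y j) = y (Suc j)))"

lemma \<sigma>_hom: "\<sigma> \<in> hom K K" and \<sigma>_y: "\<sigma> (y j) = y (Suc j)"
  using someI_ex[OF shift_exists] by (auto simp: \<sigma>_def)

sublocale \<sigma>: group_hom K K \<sigma>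
  by unfold_locales (rule \<sigma>_hom)

lemma \<sigma>_pow_hom: "\<sigma> ^^ j \<in> hom K K"
  by (induction j) (auto simp: hom_def Pi_iff)

lemma \<sigma>_pow_closed [simp]: "g \<in> carrier K \<Longrightarrow> (\<sigma> ^^ j) g \<in> carrier K"
  using \<sigma>_pow_hom by (auto simp: hom_def)

lemma \<sigma>_pow_y: "(\<sigma> ^^ j) (y i) = y (i + j)"
  by (induction j) (auto simp: \<sigma>_y)

text \<open>On generators this is the reduction of indices modulo \<open>n\<close>. It makes
  \<sigma> invertible and later yields the relation \<open>t [^] n = \<one>\<close> for
  \<open>act_t\<close>.\<close>

lemma \<sigma>_pow_n: "g \<in> carrier K \<Longrightarrow> (\<sigma> ^^ n) g = g"
  by (rule hom_eq[OF group_axioms \<sigma>_pow_hom, of "\<lambda>g. g"])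
    (simp_all add: \<sigma>_pow_y hom_def, simp add: y_def)

lemma \<sigma>_cyc_word:
  "\<sigma> (word_val K gen (cyc_word n l (Suc i))) = word_val K gen (cyc_word n l (Suc (Suc i)))"
proof (induction l arbitrary: i)
  case (Suc l)
  have "word_val K gen (cyc_word n l (Suc (Suc i))) \<in> carrier K"
    using n_pos by (intro word_val_closed[OF gen_closed] cyc_word_in_words)
  then show ?case
    using \<sigma>_y[of i] y_closed[of i] by (simp add: cyc_word_Suc Suc y_def mod_Suc_eq)
qed simp

lemma \<sigma>_\<Delta>: "\<sigma> \<Delta> = \<Delta>"
  using \<sigma>_cyc_word[of m 0] by (simp add: cyc_word_\<Delta>)

text \<open>Both \<open>\<sigma> ^^ m\<close> and conjugation by \<Delta> are endomorphisms of
  \<open>K\<close>, and by \<open>y_\<Delta>\<close> they agree on the generators.\<close>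

lemma \<Delta>_\<sigma>_pow:
  assumes "g \<in> carrier K"
  shows "\<Delta> \<otimes> (\<sigma> ^^ m) g = g \<otimes> \<Delta>"
proof -
  let ?c = "\<lambda>g. inv \<Delta> \<otimes> g \<otimes> \<Delta>"
  have "?c \<in> hom K K"
  proof (rule homI)
    fix g h assume gh: "g \<in> carrier K" "h \<in> carrier K"
    then have "?c g \<otimes> ?c h = inv \<Delta> \<otimes> g \<otimes> (\<Delta> \<otimes> inv \<Delta>) \<otimes> h \<otimes> \<Delta>"
      by (simp only: m_assoc m_closed inv_closed \<Delta>_closed)
    then show "?c (g \<otimes> h) = ?c g \<otimes> ?c h" using gh by (simp add: m_assoc)
  qed simp
  then have "(\<sigma> ^^ m) g = ?c g"
    by (rule hom_eq[OF group_axioms \<sigma>_pow_hom])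
      (use assms in \<open>simp_all add: \<sigma>_pow_y m_assoc y_\<Delta>, simp flip: m_assoc\<close>)
  then show ?thesis using assms by (simp flip: m_assoc)
qed

section \<open>The permutations for \<open>s\<close>, \<open>t\<close> and \<open>z\<close>\<close>

definition S where "S = carrier K \<times> {..<m}"

definition act_left where "act_left g = (\<lambda>p\<in>S. (g \<otimes> fst p, snd p))"
definition act_t where "act_t = (\<lambda>p\<in>S. (\<sigma> (fst p), snd p))"
text \<open>A pair \<open>(g, i)\<close> models the coset of \<open>g z^i\<close> modulo the
  subgroup generated by \<open>t\<close>. The carry reflects \<open>z^m = \<Delta> t^m\<close> in
  \<open>G\<close>, which puts \<open>g z^m\<close> and \<open>g \<Delta>\<close> into the same
  coset.\<close>

definition act_z where
  "act_z = (\<lambda>p\<in>S. if Suc (snd p) < m then (fst p, Suc (snd p)) else (fst p \<otimes> \<Delta>, 0))"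

lemma act_left_closed: "g \<in> carrier K \<Longrightarrow> act_left g \<in> carrier (BijGroup S)"
  unfolding act_left_def
  by (intro restrict_in_BijGroup bij_betw_byWitness[where f' = "\<lambda>p. (inv g \<otimes> fst p, snd p)"])
    (auto simp: S_def m_assoc[symmetric])

lemma act_left_hom: "act_left \<in> hom K (BijGroup S)"
proof (rule homI)
  fix g h assume "g \<in> carrier K" "h \<in> carrier K"
  then show "act_left (g \<otimes> h) = act_left g \<otimes>\<^bsub>BijGroup S\<^esub> act_left h"
    by (intro BijGroup_eqI[of _ S])
      (simp_all add: act_left_closed BijGroup_mult_apply group.is_monoid[OF group_BijGroup]
        monoid.m_closed, auto simp: act_left_def S_def m_assoc)
qed (rule act_left_closed)

lemma act_t_closed: "act_t \<in> carrier (BijGroup S)"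
proof -
  \<comment> \<open>By \<open>\<sigma>_pow_n\<close> the inverse of \<sigma> is its power with
    exponent \<open>n - 1\<close>.\<close>
  have "\<sigma> ((\<sigma> ^^ (n - 1)) g) = g" "(\<sigma> ^^ (n - 1)) (\<sigma> g) = g" if "g \<in> carrier K" for g
    using \<sigma>_pow_n[OF that] n_pos
    by (metis Suc_diff_1 comp_apply funpow.simps(2), metis Suc_diff_1 comp_apply funpow_Suc_right)
  then show ?thesis
    unfolding act_t_def
    by (intro restrict_in_BijGroup bij_betw_byWitness[where f' = "\<lambda>p. ((\<sigma> ^^ (n - 1)) (fst p), snd p)"])
      (auto simp: S_def)
qed

lemma act_z_closed: "act_z \<in> carrier (BijGroup S)"
  unfolding act_z_def
  by (intro restrict_in_BijGroup bij_betw_byWitness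
      [where f' = "\<lambda>p. if snd p = 0 then (fst p \<otimes> inv \<Delta>, m - 1) else (fst p, snd p - 1)"])
    (use m_pos in \<open>auto simp: S_def m_assoc split: if_splits\<close>)

lemma act_t_pow: "p \<in> S \<Longrightarrow> (act_t ^^ j) p = ((\<sigma> ^^ j) (fst p), snd p)"
  by (induction j) (auto simp: act_t_def S_def)

text \<open>The bound \<open>j \<le> m\<close> allows at most one carry; for \<open>j = m\<close>
  exactly one occurs, and the result is right multiplication by \<Delta>.\<close>

lemma act_z_pow:
  "p \<in> S \<Longrightarrow> j \<le> m \<Longrightarrow> (act_z ^^ j) p =
    (if snd p + j < m then (fst p, snd p + j) else (fst p \<otimes> \<Delta>, snd p + j - m))"
proof (induction j)
  case (Suc j)
  then have IH: "(act_z ^^ j) p =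
      (if snd p + j < m then (fst p, snd p + j) else (fst p \<otimes> \<Delta>, snd p + j - m))"
    by simp
  show ?case
    unfolding funpow.simps comp_apply IH using Suc.prems
    by (auto simp: act_z_def S_def Suc_diff_le)
qed (auto simp: S_def)

text \<open>Each further factor \<open>st\<close> shifts the accumulated cyclic word by \<sigma> and
  puts \<open>y 0\<close> in front, which lengthens the word by one letter.\<close>

lemma act_st_pow:
  "p \<in> S \<Longrightarrow> ((act_left (y 0) \<otimes>\<^bsub>BijGroup S\<^esub> act_t) ^^ j) p =
    (word_val K gen (cyc_word n j 1) \<otimes> (\<sigma> ^^ j) (fst p), snd p)"
proof (induction j)
  case (Suc j)
  have c: "word_val K gen (cyc_word n j i) \<in> carrier K" for i
    using n_pos by (intro word_val_closed[OF gen_closed] cyc_word_in_words)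
  have "(y 0 \<otimes> \<sigma> (word_val K gen (cyc_word n j 1))) = word_val K gen (cyc_word n (Suc j) 1)"
    using \<sigma>_cyc_word[of j 0] by (simp add: cyc_word_Suc[of n j 0, simplified] y_def)
  moreover have "(word_val K gen (cyc_word n j 1) \<otimes> (\<sigma> ^^ j) (fst p), snd p) \<in> S"
    using Suc.prems c by (auto simp: S_def)
  ultimately show ?case
    using Suc c by (simp add: BijGroup_mult_apply act_left_closed act_t_closed)
      (auto simp: act_left_def act_t_def S_def m_assoc[symmetric])
qed (auto simp: S_def)

text \<open>The relation \<open>(st)^m = z^m\<close> turns into
  \<open>\<Delta>_\<sigma>_pow\<close>. The map \<open>act_z\<close> commutes with
  \<open>act_left\<close> because left and right multiplications commute, and with
  \<open>act_t\<close> because \<sigma> fixes \<Delta>.\<close>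

lemma J_action:
  obtains \<rho> where "\<rho> \<in> hom (J_group k n m) (BijGroup S)"
    "\<rho> (J_gen k n m Gs) = act_left (y 0)" "\<rho> (J_gen k n m Gt) = act_t"
proof -
  interpret B: group "BijGroup S" by (rule group_BijGroup)
  interpret act: group_hom K "BijGroup S" act_left by unfold_locales (rule act_left_hom)
  let ?s = "act_left (y 0)"
  have closed [simp]: "?s \<in> carrier (BijGroup S)" "act_t \<in> carrier (BijGroup S)"
    "act_z \<in> carrier (BijGroup S)"
    by (auto simp: act_t_closed act_z_closed)
  show ?thesis
  proof (rule J_group_universal[OF group_BijGroup closed, of k n m])
    show "?s [^]\<^bsub>BijGroup S\<^esub> k = \<one>\<^bsub>BijGroup S\<^esub>"
      using act.hom_nat_pow[of "y 0" k] by (simp add: y_pow)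
    show "act_t [^]\<^bsub>BijGroup S\<^esub> n = \<one>\<^bsub>BijGroup S\<^esub>"
    proof (rule BijGroup_eqI[of _ S])
      fix p assume "p \<in> S"
      then show "(act_t [^]\<^bsub>BijGroup S\<^esub> n) p = \<one>\<^bsub>BijGroup S\<^esub> p"
        by (simp add: BijGroup_pow_apply act_t_pow)
          (auto simp: BijGroup_def S_def \<sigma>_pow_n)
    qed simp_all
    show "(?s \<otimes>\<^bsub>BijGroup S\<^esub> act_t) [^]\<^bsub>BijGroup S\<^esub> m = act_z [^]\<^bsub>BijGroup S\<^esub> m"
    proof (rule BijGroup_eqI[of _ S])
      fix p assume p: "p \<in> S"
      then show "((?s \<otimes>\<^bsub>BijGroup S\<^esub> act_t) [^]\<^bsub>BijGroup S\<^esub> m) p = (act_z [^]\<^bsub>BijGroup S\<^esub> m) p"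
        by (simp add: BijGroup_pow_apply act_st_pow act_z_pow)
          (simp add: S_def mem_Times_iff cyc_word_\<Delta> \<Delta>_\<sigma>_pow)
    qed simp_all
    show "?s \<otimes>\<^bsub>BijGroup S\<^esub> act_z = act_z \<otimes>\<^bsub>BijGroup S\<^esub> ?s"
      by (rule BijGroup_eqI[of _ S])
        (use m_pos in \<open>simp_all add: BijGroup_mult_apply,
          auto simp: act_z_def act_left_def S_def m_assoc\<close>)
    show "act_t \<otimes>\<^bsub>BijGroup S\<^esub> act_z = act_z \<otimes>\<^bsub>BijGroup S\<^esub> act_t"
      by (rule BijGroup_eqI[of _ S])
        (use m_pos in \<open>simp_all add: BijGroup_mult_apply,
          auto simp: act_z_def act_t_def S_def \<sigma>_\<Delta>\<close>)
  qed (use that in blast)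
qed

end

section \<open>The presentation\<close>

lemma (in group) conj_pow:
  assumes "x \<in> carrier G" "s \<in> carrier G"
  shows "(x \<otimes> s \<otimes> inv x) [^] (k :: nat) = x \<otimes> s [^] k \<otimes> inv x"
proof (induction k)
  case (Suc k)
  have "x \<otimes> s [^] k \<otimes> inv x \<otimes> (x \<otimes> s \<otimes> inv x) = x \<otimes> s [^] k \<otimes> (inv x \<otimes> x) \<otimes> s \<otimes> inv x"
    using assms by (simp only: m_assoc m_closed inv_closed nat_pow_closed)
  then show ?case using assms Suc by (simp add: m_assoc)
qed (use assms in simp)

lemma cyc_rels_iso_J_sub:
  fixes k n m :: nat
  defines "G \<equiv> J_group k n m" and "s \<equiv> J_gen k n m Gs" and "t \<equiv> J_gen k n m Gt"
  assumes pos: "0 < k" "0 < n" "0 < m"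
  obtains \<phi> where "\<phi> \<in> iso (pres_group {1..n} (cyc_rels k n m)) (G\<lparr>carrier := J_sub k n m 1 n m\<rparr>)"
    "\<And>j. j < n \<Longrightarrow> \<phi> (pres_gen {1..n} (cyc_rels k n m) (Suc j)) =
      t [^]\<^bsub>G\<^esub> j \<otimes>\<^bsub>G\<^esub> s \<otimes>\<^bsub>G\<^esub> inv\<^bsub>G\<^esub> (t [^]\<^bsub>G\<^esub> j)"
proof -
  define K where "K = pres_group {1..n} (cyc_rels k n m)"
  interpret K: cyclic_presentation k n m K by unfold_locales (use pos K_def in auto)
  interpret G: group G unfolding G_def by (rule group_J_group)
  define u where "u = J_gen k n m Gu"
  have closed [simp]: "s \<in> carrier G" "t \<in> carrier G" "u \<in> carrier G"
    unfolding G_def s_def t_def u_def by (rule J_gen_closed)+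
  have rels: "s [^]\<^bsub>G\<^esub> k = \<one>\<^bsub>G\<^esub>" "t [^]\<^bsub>G\<^esub> n = \<one>\<^bsub>G\<^esub>" "u [^]\<^bsub>G\<^esub> m = \<one>\<^bsub>G\<^esub>"
    "s \<otimes>\<^bsub>G\<^esub> t \<otimes>\<^bsub>G\<^esub> u = t \<otimes>\<^bsub>G\<^esub> u \<otimes>\<^bsub>G\<^esub> s" "t \<otimes>\<^bsub>G\<^esub> u \<otimes>\<^bsub>G\<^esub> s = u \<otimes>\<^bsub>G\<^esub> s \<otimes>\<^bsub>G\<^esub> t"
    unfolding G_def s_def t_def u_def by (rule J_gen_relations)+
  define x where "x j = t [^]\<^bsub>G\<^esub> j \<otimes>\<^bsub>G\<^esub> s \<otimes>\<^bsub>G\<^esub> inv\<^bsub>G\<^esub> (t [^]\<^bsub>G\<^esub> j)" for j :: nat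
  \<comment> \<open>Generators start at 1, conjugates at 0. Truncated subtraction gives
    \<open>f 0 = x 0\<close>, again a conjugate of \<open>s\<close>, so the power relation can be
    checked for every index.\<close>
  define f where "f i = x (i - 1)" for i
  have f: "f \<in> {1..n} \<rightarrow> carrier G" by (auto simp: f_def x_def)

  \<comment> \<open>The homomorphism from \<open>K\<close> to \<open>G\<close>\<close>
  define z where "z = s \<otimes>\<^bsub>G\<^esub> t \<otimes>\<^bsub>G\<^esub> u"
  have z [simp]: "z \<in> carrier G" by (simp add: z_def)
  have zt: "z \<otimes>\<^bsub>G\<^esub> t = t \<otimes>\<^bsub>G\<^esub> z"
    unfolding z_def using rels(4,5) by (metis closed G.m_assoc G.m_closed)
  \<comment> \<open>The relations say that \<open>u\<close> commutes with \<open>st\<close>, so the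
    power of \<open>stu\<close> splits, and \<open>u\<close> contributes
    \<open>\<one>\<close>.\<close>
  have "z [^]\<^bsub>G\<^esub> m = (s \<otimes>\<^bsub>G\<^esub> t) [^]\<^bsub>G\<^esub> m \<otimes>\<^bsub>G\<^esub> u [^]\<^bsub>G\<^esub> m"
    unfolding z_def using rels(4,5) by (intro G.pow_mult_distrib) (auto simp: G.m_assoc)
  then have st_pow: "(s \<otimes>\<^bsub>G\<^esub> t) [^]\<^bsub>G\<^esub> m = z [^]\<^bsub>G\<^esub> m" using rels(3) by simp
  \<comment> \<open>Moving \<open>z^m\<close> past \<open>t^i\<close> leaves a value free of
    \<open>i\<close>, which is exactly the cyclic relation.\<close>
  have cyc: "word_val G f (cyc_word n m (Suc i)) = z [^]\<^bsub>G\<^esub> m \<otimes>\<^bsub>G\<^esub> inv\<^bsub>G\<^esub> (t [^]\<^bsub>G\<^esub> m)" for i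
  proof -
    have "z [^]\<^bsub>G\<^esub> m \<otimes>\<^bsub>G\<^esub> t [^]\<^bsub>G\<^esub> i = t [^]\<^bsub>G\<^esub> i \<otimes>\<^bsub>G\<^esub> z [^]\<^bsub>G\<^esub> m"
      using zt by (intro G.group_commutes_pow G.group_commutes_pow[symmetric]) auto
    moreover have "word_val G f (cyc_word n m (Suc i)) =
        t [^]\<^bsub>G\<^esub> i \<otimes>\<^bsub>G\<^esub> z [^]\<^bsub>G\<^esub> m \<otimes>\<^bsub>G\<^esub> inv\<^bsub>G\<^esub> (t [^]\<^bsub>G\<^esub> (m + i))"
      unfolding st_pow[symmetric] using rels(2) pos
      by (intro G.word_val_cyc_conj) (auto simp: f_def x_def)
    moreover have "t [^]\<^bsub>G\<^esub> i \<otimes>\<^bsub>G\<^esub> inv\<^bsub>G\<^esub> (t [^]\<^bsub>G\<^esub> (m + i)) = inv\<^bsub>G\<^esub> (t [^]\<^bsub>G\<^esub> m)"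
      by (simp add: G.nat_pow_mult[symmetric] G.inv_mult_group G.m_assoc[symmetric])
    ultimately show ?thesis by (metis G.inv_closed G.m_assoc G.nat_pow_closed closed(2) z)
  qed
  have "word_val G f l = word_val G f r" if "(l, r) \<in> cyc_rels k n m" for l r
  proof -
    show ?thesis
      using that
    proof (cases rule: cyc_rels_cases)
      case (power i)
      then show ?thesis
        using rels(1) by (simp add: G.word_val_replicate f_def x_def G.conj_pow)
    qed (simp add: cyc)
  qed
  then obtain \<phi> where \<phi>: "\<phi> \<in> hom K G" "\<And>i. i \<in> {1..n} \<Longrightarrow> \<phi> (K.gen i) = f i"
    using pres_group_universal[OF G.group_axioms f] unfolding K_def K.gen_def by metis
  interpret \<phi>: group_hom K G \<phi> by unfold_locales (rule \<phi>(1))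
  have \<phi>_y: "\<phi> (K.y j) = x j" for j
    using \<phi>(2)[of "j mod n + 1"] pos rels(2)
    by (simp add: K.y_def f_def x_def G.pow_mod_eq Suc_le_eq)

  \<comment> \<open>Injectivity via the action\<close>
  obtain \<rho> where \<rho>: "\<rho> \<in> hom G (BijGroup K.S)" "\<rho> s = K.act_left (K.y 0)" "\<rho> t = K.act_t"
    unfolding G_def s_def t_def by (rule K.J_action)
  interpret \<rho>: group_hom G "BijGroup K.S" \<rho>
    by (intro group_hom.intro group_hom_axioms.intro group_BijGroup G.group_axioms \<rho>(1))
  have \<rho>x: "\<rho> (x j) = K.act_left (K.y j)" for j
  proof -
    let ?B = "BijGroup K.S"
    have tj: "\<rho> (t [^]\<^bsub>G\<^esub> j) = K.act_t [^]\<^bsub>?B\<^esub> j"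
      by (simp add: \<rho>.hom_nat_pow \<rho>(3))
    have c: "K.act_t \<in> carrier ?B" "K.act_left (K.y i) \<in> carrier ?B" for i
      by (simp_all add: K.act_t_closed K.act_left_closed)
    \<comment> \<open>Multiplying by \<open>t^j\<close> avoids inverses of permutations. On
      \<open>S\<close> the identity says that \<open>\<sigma> ^^ j\<close> is multiplicative and
      sends \<open>y 0\<close> to \<open>y j\<close>; cancelling the power of \<open>act_t\<close>
      gives the claim.\<close>
    have "x j \<otimes>\<^bsub>G\<^esub> t [^]\<^bsub>G\<^esub> j = t [^]\<^bsub>G\<^esub> j \<otimes>\<^bsub>G\<^esub> s"
      by (simp add: x_def G.m_assoc)
    then have "\<rho> (x j) \<otimes>\<^bsub>?B\<^esub> K.act_t [^]\<^bsub>?B\<^esub> j = K.act_t [^]\<^bsub>?B\<^esub> j \<otimes>\<^bsub>?B\<^esub> K.act_left (K.y 0)"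
      unfolding tj[symmetric] \<rho>(2)[symmetric] by (simp add: x_def flip: \<rho>.hom_mult)
    also have "\<dots> = K.act_left (K.y j) \<otimes>\<^bsub>?B\<^esub> K.act_t [^]\<^bsub>?B\<^esub> j"
    proof (rule BijGroup_eqI[of _ K.S])
      fix p assume p: "p \<in> K.S"
      then have "(K.y 0 \<otimes>\<^bsub>K\<^esub> fst p, snd p) \<in> K.S" by (auto simp: K.S_def)
      then show "(K.act_t [^]\<^bsub>?B\<^esub> j \<otimes>\<^bsub>?B\<^esub> K.act_left (K.y 0)) p =
          (K.act_left (K.y j) \<otimes>\<^bsub>?B\<^esub> K.act_t [^]\<^bsub>?B\<^esub> j) p"
        using p c K.\<sigma>_pow_hom[of j]
        by (simp add: BijGroup_mult_apply BijGroup_pow_apply K.act_left_def K.act_t_pow)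
          (auto simp: K.S_def hom_mult K.\<sigma>_pow_y)
    qed (use c in simp_all)
    finally show ?thesis using c by (simp add: x_def)
  qed
  have "\<rho> (\<phi> g) = K.act_left g" if "g \<in> carrier K" for g
    using K.hom_eq[OF group_BijGroup hom_compose[OF \<phi>(1) \<rho>(1)] K.act_left_hom _ that]
    by (simp add: \<phi>_y \<rho>x)
  \<comment> \<open>Evaluation at the base point recovers \<open>g\<close>, so
    \<open>\<rho> (\<phi> g)\<close>, and with it \<open>\<phi> g\<close>, determines
    \<open>g\<close>.\<close>
  moreover have "K.act_left g (\<one>\<^bsub>K\<^esub>, 0) = (g, 0)" if "g \<in> carrier K" for g
    using that pos by (simp add: K.act_left_def K.S_def)
  ultimately have inj: "inj_on \<phi> (carrier K)"
    by (intro inj_onI) (metis prod.inject)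

  \<comment> \<open>The image is \<open>H\<close>\<close>
  have "\<phi> ` carrier K = generate G (\<phi> ` K.gen ` {1..n})"
    using \<phi>.generate_img[of "K.gen ` {1..n}"] K.gen_closed pres_group_generate
    unfolding K_def K.gen_def by (metis image_subset_iff_funcset)
  also have "\<phi> ` K.gen ` {1..n} = x ` {..<n}"
  proof -
    have "{1..n} = Suc ` {..<n}"
      by (simp add: lessThan_atLeast0 image_Suc_atLeastLessThan atLeastLessThanSuc_atLeastAtMost)
    then show ?thesis
      unfolding image_image by (auto simp: image_image \<phi>(2) f_def intro!: image_cong)
  qed
  also have "generate G (x ` {..<n}) = J_sub k n m 1 n m"
    unfolding x_def G_def s_def t_def by (rule J_sub_generate[symmetric]) (fact pos)+
  finally have img: "\<phi> ` carrier K = J_sub k n m 1 n m" .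
  show ?thesis
  proof
    have "\<phi> \<in> hom K (G\<lparr>carrier := J_sub k n m 1 n m\<rparr>)"
      using \<phi>(1) img by (auto simp: hom_def)
    then show "\<phi> \<in> iso (pres_group {1..n} (cyc_rels k n m)) (G\<lparr>carrier := J_sub k n m 1 n m\<rparr>)"
      unfolding K_def[symmetric] iso_def using inj img by (auto simp: bij_betw_def)
    show "\<phi> (pres_gen {1..n} (cyc_rels k n m) (Suc j)) =
        t [^]\<^bsub>G\<^esub> j \<otimes>\<^bsub>G\<^esub> s \<otimes>\<^bsub>G\<^esub> inv\<^bsub>G\<^esub> (t [^]\<^bsub>G\<^esub> j)" if "j < n" for j
      using \<phi>(2)[of "Suc j"] that by (simp add: f_def x_def K.gen_def)
  qed
qed

text \<open>Equalities between arbitrary cyclic words follow from the comparisons with the first one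
  by symmetry and transitivity.\<close>

lemma toric_group_eq:
  assumes "0 < n"
  shows "toric_group k n m = pres_group {1..n} (cyc_rels k n m)"
  unfolding toric_group_def
proof (rule pres_group_cong)
  let ?R = "power_rels k n \<union> {(cyc_word n m i, cyc_word n m j) |i j. i \<in> {1..n} \<and> j \<in> {1..n}}"
  have rel: "pres_eq {1..n} R l r"
    if "(l, r) \<in> R" "l \<in> words {1..n}" "r \<in> words {1..n}" for R :: "(nat word \<times> nat word) set" and l r
    using pres_eq.rel[of "[]" "{1..n}" "[]" l r R] that by simp
  show "pres_eq {1..n} ?R l r"
    if "(l, r) \<in> cyc_rels k n m" "l \<in> words {1..n}" "r \<in> words {1..n}" for l r
    using that assms by (intro rel) (fastforce simp: cyc_rels_def)+
  have first: "pres_eq {1..n} (cyc_rels k n m) (cyc_word n m 1) (cyc_word n m i)" if "i \<in> {1..n}" for i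
  proof (cases "i = 1")
    case False
    then show ?thesis
      using that assms by (intro rel cyc_word_in_words) (auto simp: cyc_rels_def)
  qed (use assms in \<open>simp add: pres_eq.refl cyc_word_in_words del: One_nat_def\<close>)
  show "pres_eq {1..n} (cyc_rels k n m) l r"
    if "(l, r) \<in> ?R" "l \<in> words {1..n}" "r \<in> words {1..n}" for l r
    using that(1)
  proof
    assume "(l, r) \<in> power_rels k n"
    then show ?thesis using that by (intro rel) (auto simp: cyc_rels_def)
  next
    assume "(l, r) \<in> {(cyc_word n m i, cyc_word n m j) |i j. i \<in> {1..n} \<and> j \<in> {1..n}}"
    then show ?thesis using first by (blast intro: pres_eq.sym pres_eq.trans)
  qed
qed

theorem theorem2p12:
  fixes k n m :: nat
  assumes "k \<ge> 2" and "n \<ge> 2" and "m \<ge> 2" and "coprime n m"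
  shows "let G = J_group k n m;
             H = G\<lparr>carrier := J_sub k n m 1 n m\<rparr>;
             s = J_gen k n m Gs;
             t = J_gen k n m Gt
         in has_presentation H {1..n}
              (power_rels k n \<union> {(cyc_word n m 1, cyc_word n m i) | i. i \<in> {2..n}})
              (\<lambda>i. t [^]\<^bsub>G\<^esub> (int i - 1) \<otimes>\<^bsub>G\<^esub> s \<otimes>\<^bsub>G\<^esub> t [^]\<^bsub>G\<^esub> (- int i + 1))
          \<and> (n < m \<longrightarrow> toric_group k n m \<cong> H)"
proof -
  let ?G = "J_group k n m" and ?s = "J_gen k n m Gs" and ?t = "J_gen k n m Gt"
  let ?H = "?G\<lparr>carrier := J_sub k n m 1 n m\<rparr>"
  interpret group ?G by (rule group_J_group)
  obtain \<phi> where \<phi>: "\<phi> \<in> iso (pres_group {1..n} (cyc_rels k n m)) ?H"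
    "\<And>j. j < n \<Longrightarrow> \<phi> (pres_gen {1..n} (cyc_rels k n m) (Suc j)) =
      ?t [^]\<^bsub>?G\<^esub> j \<otimes>\<^bsub>?G\<^esub> ?s \<otimes>\<^bsub>?G\<^esub> inv\<^bsub>?G\<^esub> (?t [^]\<^bsub>?G\<^esub> j)"
    using cyc_rels_iso_J_sub[of k n m] assms by auto
  have "\<phi> (pres_gen {1..n} (cyc_rels k n m) i) =
      ?t [^]\<^bsub>?G\<^esub> (int i - 1) \<otimes>\<^bsub>?G\<^esub> ?s \<otimes>\<^bsub>?G\<^esub> ?t [^]\<^bsub>?G\<^esub> (- int i + 1)" if i: "i \<in> {1..n}" for i
  proof -
    \<comment> \<open>With \<open>i = Suc j\<close> the integer exponents become
      \<open>int j\<close> and \<open>- int j\<close>, so the last factor is the inverse of the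
      natural power \<open>t^j\<close>.\<close>
    obtain j where "i = Suc j" "j < n" using i by (cases i) auto
    moreover have "- int (Suc j) + 1 = - int j" "int (Suc j) - 1 = int j" by auto
    ultimately show ?thesis
      using \<phi>(2)[of j] J_gen_closed[of k n m Gt] by (simp only: int_pow_neg_int int_pow_int)
  qed
  then have "has_presentation ?H {1..n} (cyc_rels k n m)
      (\<lambda>i. ?t [^]\<^bsub>?G\<^esub> (int i - 1) \<otimes>\<^bsub>?G\<^esub> ?s \<otimes>\<^bsub>?G\<^esub> ?t [^]\<^bsub>?G\<^esub> (- int i + 1))"
    unfolding has_presentation_def using \<phi>(1) by blast
  moreover have "toric_group k n m \<cong> ?H"
    using toric_group_eq[of n k m] \<phi>(1) assms by (auto simp: is_iso_def)
  ultimately show ?thesis by (simp add: cyc_rels_def Let_def)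
qed

end
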